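(* Let $n=2k$ be even and let $(F_1,F_2)$ be an oriented transverse pair in $\mathrm{Flag}^+(\mathbb{R}^n)$. The complement in $\mathbb{RP}^{n-1}$ of the open halfspace $\mathcal{H}(F_1,F_2)$ is the closed opposite halfspace $\overline{\mathcal{H}}(F_2,F_1)$.
   Context: Oriented flags ($n=2k$). $\mathbb{R}^n$ has its standard orientation. Consider complete flags $F^{(1)}\subset\dots\subset F^{(n-1)}$ in $\mathbb{R}^n$ ($\dim F^{(i)}=i$) with a choice of orientation on each $F^{(i)}$. As $n$ is even, $\mathrm{Flag}^+(\mathbb{R}^n)$ is the quotient of the set of these by simultaneously reversing the orientations of all odd-dimensional $F^{(i)}$; an oriented flag before passing to this quotient is called a lift. Direct sums of oriented subspaces are oriented by concatenating positive bases in order. A pair $(F_1,F_2)$ is oriented transverse if there are lifts with $\widehat F_1^{(i)}\oplus\widehat F_2^{(n-i)}=\mathbb{R}^n$ as oriented spaces for $1\le i\le n-1$; this relation is symmetric on $\mathrm{Flag}^+(\mathbb{R}^n)$. For an oriented transverse pair there is a positively oriented ordered basis $\mathcal{E}=(e_1,\dots,e_n)$ of $\mathbb{R}^n$, unique up to positive scaling of the basis vectors (and global sign), such that $F_1$ is the class of the oriented flag with $i$-th space $\mathrm{span}(e_1,\dots,e_i)$ and $F_2$ the class of the oriented flag with $i$-th space $\mathrm{span}(e_{n-i+1},\dots,e_n)$, each span oriented by the listed order; $\mathcal{E}$ is called adapted to $(F_1,F_2)$. Halfspaces. For $v\neq 0$, $S^+_{\mathcal{E}}(v)$ (resp. $S^-_{\mathcal{E}}(v)$)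 is the maximal (resp. minimal) number of sign changes in the sequence of coordinates of $v$ in the basis $\mathcal{E}$, over all ways of assigning signs to zero coordinates. For an oriented transverse pair with adapted basis $\mathcal{E}$, $\mathcal{H}(F_1,F_2)=\{[v]\in\mathbb{RP}^{n-1}: S^+_{\mathcal{E}}(v)\le k-1\}$ and $\overline{\mathcal{H}}(F_1,F_2)=\{[v]\in\mathbb{RP}^{n-1}: S^-_{\mathcal{E}}(v)\le k-1\}$. *)

theory Defs
  imports "HOL-Analysis.Analysis" "Jordan_Normal_Form.Determinant"
begin

section \<open>Oriented subspaces\<close>

definition ordered_basis :: "'a::real_vector set \<Rightarrow> 'a list \<Rightarrow> bool" where
  "ordered_basis W bs \<longleftrightarrow>
     distinct bs \<and> Real_Vector_Spaces.independent (set bs) \<and> Real_Vector_Spaces.span (set bs) = W"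

text \<open>The change-of-basis matrix has varying size, hence the determinant of
  \<open>Jordan_Normal_Form\<close>, whose matrices carry their dimensions as values.\<close>

definition orientation_rel :: "'a::real_vector set \<Rightarrow> ('a list \<times> 'a list) set" where
  "orientation_rel W = {(bs, cs). ordered_basis W bs \<and> ordered_basis W cs \<and>
     (\<exists>M \<in> carrier_mat (length bs) (length bs).
        length cs = length bs \<and>
        (\<forall>j<length bs. cs ! j = (\<Sum>l<length bs. (M $$ (l, j)) *\<^sub>R (bs ! l))) \<and>
        Determinant.det M > (0::real))}"

text \<open>An orientation is the set of its positive ordered bases. (The zero space, which never
  occurs below, would get one orientation only.)\<close>

definition orientations :: "'a::real_vector set \<Rightarrow> 'a list set set" where
  "orientations W = {bs. ordered_basis W bs} // orientation_rel W"

type_synonym 'a oriented_space = "'a set \<times> 'a list set"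

definition reverse_orientation :: "'a::real_vector oriented_space \<Rightarrow> 'a oriented_space" where
  "reverse_orientation X = (fst X, {bs. ordered_basis (fst X) bs} - snd X)"

definition oriented_span :: "'a::real_vector list \<Rightarrow> 'a oriented_space" where
  "oriented_span bs = (let W = Real_Vector_Spaces.span (set bs) in (W, orientation_rel W `` {bs}))"

text \<open>If the sum is not direct, no concatenation is a basis of it and the second component
  is empty; so an equation with an oriented space forces directness.\<close>

definition oriented_sum ::
    "'a::real_vector oriented_space \<Rightarrow> 'a oriented_space \<Rightarrow> 'a oriented_space" where
  "oriented_sum X Y = (let W = {x + y | x y. x \<in> fst X \<and> y \<in> fst Y} in
     (W, orientation_rel W `` {bs @ cs | bs cs. bs \<in> snd X \<and> cs \<in> snd Y}))"

text \<open>The linear order on the index type \<^typ>\<open>'n\<close> numbers the coordinates of \<open>\<real>\<^sup>n\<close>.\<close>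

definition standard_basis :: "(real ^ 'n::{finite,linorder}) list" where
  "standard_basis = map (\<lambda>i. axis i 1) (sorted_list_of_set UNIV)"

definition standard_space :: "(real ^ 'n::{finite,linorder}) oriented_space" where
  "standard_space = (UNIV, orientation_rel UNIV `` {standard_basis})"

section \<open>Oriented flags\<close>

text \<open>Lifts are functions on \<open>{1..<n}\<close>, made \<^const>\<open>undefined\<close> elsewhere so that equality
  of lifts is equality of flags.\<close>

type_synonym 'n lift = "nat \<Rightarrow> (real ^ 'n) oriented_space"

definition flag_lifts :: "'n::finite lift set" where
  "flag_lifts = {L \<in> extensional {1..<CARD('n)}.
     (\<forall>i\<in>{1..<CARD('n)}. subspace (fst (L i)) \<and> dim (fst (L i)) = i \<and>
                            snd (L i) \<in> orientations (fst (L i))) \<and>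
     (\<forall>i\<in>{1..<CARD('n)}. \<forall>j\<in>{1..<CARD('n)}. i \<le> j \<longrightarrow> fst (L i) \<subseteq> fst (L j))}"

definition reverse_odd :: "'n::finite lift \<Rightarrow> 'n lift" where
  "reverse_odd L =
     (\<lambda>i\<in>{1..<CARD('n)}. if odd i then reverse_orientation (L i) else L i)"

definition lift_rel :: "('n::finite lift \<times> 'n lift) set" where
  "lift_rel = {(L, L'). L \<in> flag_lifts \<and> L' \<in> flag_lifts \<and> (L' = L \<or> L' = reverse_odd L)}"

type_synonym 'n oriented_flag = "'n lift set"

definition Flag_plus :: "'n::finite oriented_flag set" where
  "Flag_plus = flag_lifts // lift_rel"

definition oriented_transverse ::
    "'n::{finite,linorder} oriented_flag \<Rightarrow> 'n oriented_flag \<Rightarrow> bool" where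
  "oriented_transverse F1 F2 \<longleftrightarrow> (\<exists>L1\<in>F1. \<exists>L2\<in>F2. \<forall>i\<in>{1..<CARD('n)}.
     oriented_sum (L1 i) (L2 (CARD('n) - i)) = standard_space)"

definition adapted ::
    "(real ^ 'n::{finite,linorder}) list \<Rightarrow> 'n oriented_flag \<Rightarrow> 'n oriented_flag \<Rightarrow> bool" where
  "adapted E F1 F2 \<longleftrightarrow> E \<in> snd standard_space \<and>
     F1 = lift_rel `` {\<lambda>i\<in>{1..<CARD('n)}. oriented_span (take i E)} \<and>
     F2 = lift_rel `` {\<lambda>i\<in>{1..<CARD('n)}. oriented_span (drop (CARD('n) - i) E)}"

text \<open>For an oriented transverse pair, adapted bases exist and are unique up to positive scaling
  of the basis vectors and a global sign; the sign-change counts below do not depend on these.\<close>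

definition adapted_basis ::
    "'n::{finite,linorder} oriented_flag \<Rightarrow> 'n oriented_flag \<Rightarrow> (real ^ 'n::{finite,linorder}) list" where
  "adapted_basis F1 F2 = (SOME E. adapted E F1 F2)"

section \<open>Sign changes and halfspaces\<close>

definition coordinates :: "'a::real_vector list \<Rightarrow> 'a \<Rightarrow> real list" where
  "coordinates E v = map (representation (set E) v) E"

definition sign_assignments :: "real list \<Rightarrow> real list set" where
  "sign_assignments xs = {ss. length ss = length xs \<and>
     (\<forall>j<length xs. ss ! j \<in> {-1, 1} \<and> (xs ! j \<noteq> 0 \<longrightarrow> ss ! j = sgn (xs ! j)))}"

definition sign_changes :: "real list \<Rightarrow> nat" where
  "sign_changes ss = card {j. Suc j < length ss \<and> ss ! j \<noteq> ss ! Suc j}"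

definition S_plus :: "'a::real_vector list \<Rightarrow> 'a \<Rightarrow> nat" where
  "S_plus E v = Max (sign_changes ` sign_assignments (coordinates E v))"

definition S_minus :: "'a::real_vector list \<Rightarrow> 'a \<Rightarrow> nat" where
  "S_minus E v = Min (sign_changes ` sign_assignments (coordinates E v))"

text \<open>Points of projective space are lines through the origin.\<close>

definition projective_space :: "'a::real_vector set set" where
  "projective_space = {Real_Vector_Spaces.span {v} | v. v \<noteq> 0}"

text \<open>Used for even \<open>CARD('n) = 2 * k\<close>; then \<open>k \<ge> 1\<close>, so the subtraction does not truncate.\<close>

definition open_halfspace ::
    "'n::{finite,linorder} oriented_flag \<Rightarrow> 'n oriented_flag \<Rightarrow> (real ^ 'n::{finite,linorder}) set set" where
  "open_halfspace F1 F2 = {Real_Vector_Spaces.span {v} | v.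
     v \<noteq> 0 \<and> S_plus (adapted_basis F1 F2) v \<le> CARD('n) div 2 - 1}"

definition closed_halfspace ::
    "'n::{finite,linorder} oriented_flag \<Rightarrow> 'n oriented_flag \<Rightarrow> (real ^ 'n::{finite,linorder}) set set" where
  "closed_halfspace F1 F2 = {Real_Vector_Spaces.span {v} | v.
     v \<noteq> 0 \<and> S_minus (adapted_basis F1 F2) v \<le> CARD('n) div 2 - 1}"

end

theory Submission
  imports Defs
begin

text \<open>Let \<open>n = 2 k\<close> and let \<open>E = (e\<^sub>1, \<dots>, e\<^sub>n)\<close> be adapted to \<open>(F1, F2)\<close>. Then the reversed
  basis with alternating signs, \<open>(e\<^sub>n, - e\<^sub>n\<^sub>-\<^sub>1, e\<^sub>n\<^sub>-\<^sub>2, \<dots>)\<close>, is adapted to \<open>(F2, F1)\<close>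
  (\<open>adapted_alt_rev\<close>): the alternating signs compensate the sign of the reversal permutation in
  every dimension, up to the reversal of all odd-dimensional orientations that is divided out in
  the flag space. The coordinates of a vector in the new basis are again the old ones reversed
  and with alternating signs, and this operation exchanges the places with and without a sign
  change. With zero coordinates, whose signs are free, it exchanges minimum and maximum:
  \<open>S_minus\<close> in the new basis plus \<open>S_plus\<close> in the old one is \<open>n - 1 = 2 k - 1\<close>
  (\<open>S_minus_alt_rev\<close>). So the first is at most \<open>k - 1\<close> exactly when the second is not.

  As the halfspaces refer to arbitrarily chosen adapted bases, it must also be known that adapted
  bases exist (\<open>adapted_exists\<close>) and that two of them differ by scaling factors of one common
  sign (\<open>adapted_unique\<close>), which does not affect sign changes. Orientations are compared through
  the determinant of the change of basis, which is multiplicative (\<open>basis_det_trans\<close>).\<close>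

section \<open>Coordinates and change of basis\<close>

lemma ordered_basis_finite_span:
  assumes "ordered_basis W bs"
  shows "distinct bs" "Real_Vector_Spaces.independent (set bs)"
    "Real_Vector_Spaces.span (set bs) = W" "dim W = length bs"
proof -
  show *: "distinct bs" "Real_Vector_Spaces.independent (set bs)"
      "Real_Vector_Spaces.span (set bs) = W"
    using assms by (auto simp: ordered_basis_def)
  show "dim W = length bs"
    using * dim_span_eq_card_independent[of "set bs"] distinct_card[of bs] by auto
qed

lemma ordered_basis_length_eq:
  assumes "ordered_basis W bs" "ordered_basis W cs"
  shows "length cs = length bs"
  using ordered_basis_finite_span(4)[OF assms(1)] ordered_basis_finite_span(4)[OF assms(2)] by simp

lemma ordered_basis_if_spanning:
  fixes bs cs :: "'a::euclidean_space list"
  assumes "ordered_basis W bs" "length cs = length bs"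
    "Real_Vector_Spaces.span (set cs) = W"
  shows "ordered_basis W cs"
proof -
  have dim: "dim W = length cs"
    using ordered_basis_finite_span(4)[OF assms(1)] assms(2) by simp
  have "dim W \<le> card (set cs)"
    using dim_le_card[of W "set cs"] assms(3) by simp
  then have card: "card (set cs) = length cs"
    using dim card_length[of cs] by simp
  have "Real_Vector_Spaces.independent (set cs)"
    by (rule card_le_dim_spanning[of _ W])
      (use assms(3) dim card in \<open>auto simp: span_superset intro: span_base\<close>)
  then show ?thesis
    using assms(3) card by (simp add: ordered_basis_def card_distinct)
qed

lemma ordered_basis_if_independent:
  fixes cs :: "'a::euclidean_space list"
  assumes "subspace W" "length cs = dim W" "distinct cs" "set cs \<subseteq> W"
    "Real_Vector_Spaces.independent (set cs)"
  shows "ordered_basis W cs"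
proof -
  have "W \<subseteq> Real_Vector_Spaces.span (set cs)"
    by (rule card_ge_dim_independent) (use assms in \<open>auto simp: distinct_card\<close>)
  then show ?thesis
    using assms span_minimal[of "set cs" W] by (auto simp: ordered_basis_def)
qed

lemma length_coordinates [simp]: "length (coordinates bs v) = length bs"
  by (simp add: coordinates_def)

lemma sum_coordinates:
  assumes "ordered_basis W bs" "v \<in> W"
  shows "(\<Sum>l<length bs. coordinates bs v ! l *\<^sub>R bs ! l) = v"
proof -
  note b = ordered_basis_finite_span[OF assms(1)]
  have "(\<Sum>l<length bs. coordinates bs v ! l *\<^sub>R bs ! l) =
      (\<Sum>l<length bs. representation (set bs) v (bs ! l) *\<^sub>R bs ! l)"
    by (simp add: coordinates_def)
  also have "\<dots> = (\<Sum>b\<in>set bs. representation (set bs) v b *\<^sub>R b)"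
    by (rule sum.reindex_bij_betw[OF bij_betw_nth]) (use b in auto)
  also have "\<dots> = v"
    by (rule sum_representation_eq) (use b assms(2) in auto)
  finally show ?thesis .
qed

lemma coordinates_eqI:
  assumes "ordered_basis W bs" "length xs = length bs"
    "(\<Sum>l<length bs. xs ! l *\<^sub>R bs ! l) = v"
  shows "coordinates bs v = xs"
proof (rule nth_equalityI)
  show "length (coordinates bs v) = length xs" using assms by simp
  fix i assume "i < length (coordinates bs v)"
  then have i: "i < length bs" by simp
  note b = ordered_basis_finite_span[OF assms(1)]
  have "representation (set bs) v =
      (\<lambda>b. \<Sum>l<length bs. representation (set bs) (xs ! l *\<^sub>R bs ! l) b)"
    unfolding assms(3)[symmetric]
    by (rule representation_sum[OF b(2)]) (auto intro!: span_base Real_Vector_Spaces.span_scale[OF span_base])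
  also have "\<dots> = (\<lambda>b. \<Sum>l<length bs. xs ! l * (if b = bs ! l then 1 else 0))"
    using b by (intro ext sum.cong)
      (auto simp: representation_scale span_base representation_basis)
  finally have "representation (set bs) v (bs ! i) =
      (\<Sum>l<length bs. xs ! l * (if bs ! i = bs ! l then 1 else 0))" by simp
  also have "\<dots> = (\<Sum>l<length bs. if l = i then xs ! l else 0)"
    using b i by (intro sum.cong) (auto simp: nth_eq_iff_index_eq)
  also have "\<dots> = xs ! i" using i by simp
  finally show "coordinates bs v ! i = xs ! i"
    using i by (simp add: coordinates_def)
qed

lemma ordered_basis_nth_in: "ordered_basis W bs \<Longrightarrow> j < length bs \<Longrightarrow> bs ! j \<in> W"
  by (auto simp: ordered_basis_def intro: span_base)

definition transition_matrix :: "'a::real_vector list \<Rightarrow> 'a list \<Rightarrow> real mat" where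
  "transition_matrix bs cs =
     mat (length bs) (length bs) (\<lambda>(l, j). coordinates bs (cs ! j) ! l)"

text \<open>Only the sign matters: it tells whether two bases of the same space are equally oriented.
  Unlike the existential in \<^const>\<open>orientation_rel\<close>, it can be computed and multiplied along
  chains of bases.\<close>

definition basis_det :: "'a::real_vector list \<Rightarrow> 'a list \<Rightarrow> real" where
  "basis_det bs cs = Determinant.det (transition_matrix bs cs)"

lemma transition_matrix_carrier [simp]:
  "transition_matrix bs cs \<in> carrier_mat (length bs) (length bs)"
  by (simp add: transition_matrix_def)

lemma dim_transition_matrix [simp]:
  "dim_row (transition_matrix bs cs) = length bs" "dim_col (transition_matrix bs cs) = length bs"
  by (simp_all add: transition_matrix_def)

lemma transition_matrix_eqI:
  assumes "ordered_basis W bs" "M \<in> carrier_mat (length bs) (length bs)"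
    "\<And>j. j < length bs \<Longrightarrow> cs ! j = (\<Sum>l<length bs. M $$ (l, j) *\<^sub>R bs ! l)"
  shows "transition_matrix bs cs = M"
proof (rule eq_matI)
  show "dim_row (transition_matrix bs cs) = dim_row M"
       "dim_col (transition_matrix bs cs) = dim_col M"
    using assms(2) by (auto simp: transition_matrix_def)
  fix i j assume "i < dim_row M" "j < dim_col M"
  then have ij: "i < length bs" "j < length bs" using assms(2) by auto
  have "coordinates bs (cs ! j) = map (\<lambda>l. M $$ (l, j)) [0..<length bs]"
    by (rule coordinates_eqI[OF assms(1)]) (use assms(3) ij in auto)
  then show "transition_matrix bs cs $$ (i, j) = M $$ (i, j)"
    using ij by (simp add: transition_matrix_def)
qed

lemma transition_matrix_expand:
  assumes "ordered_basis W bs" "j < length bs" "cs ! j \<in> W"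
  shows "cs ! j = (\<Sum>l<length bs. transition_matrix bs cs $$ (l, j) *\<^sub>R bs ! l)"
  using sum_coordinates[OF assms(1,3)] assms(2) by (simp add: transition_matrix_def)

lemma orientation_rel_iff:
  "(bs, cs) \<in> orientation_rel W \<longleftrightarrow>
     ordered_basis W bs \<and> ordered_basis W cs \<and> basis_det bs cs > 0"
proof
  assume "(bs, cs) \<in> orientation_rel W"
  then obtain M where M: "ordered_basis W bs" "ordered_basis W cs"
      "M \<in> carrier_mat (length bs) (length bs)" "Determinant.det M > 0"
      "\<And>j. j < length bs \<Longrightarrow> cs ! j = (\<Sum>l<length bs. M $$ (l, j) *\<^sub>R bs ! l)"
    unfolding orientation_rel_def by auto
  then have "transition_matrix bs cs = M"
    by (intro transition_matrix_eqI) auto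
  with M show "ordered_basis W bs \<and> ordered_basis W cs \<and> basis_det bs cs > 0"
    by (simp add: basis_det_def)
next
  assume *: "ordered_basis W bs \<and> ordered_basis W cs \<and> basis_det bs cs > 0"
  then have len: "length cs = length bs" using ordered_basis_length_eq by blast
  have "\<forall>j<length bs. cs ! j = (\<Sum>l<length bs. transition_matrix bs cs $$ (l, j) *\<^sub>R bs ! l)"
    using * len by (auto intro!: transition_matrix_expand ordered_basis_nth_in)
  with * len show "(bs, cs) \<in> orientation_rel W"
    unfolding orientation_rel_def basis_det_def
    by (auto intro!: bexI[of _ "transition_matrix bs cs"])
qed

lemma basis_det_self [simp]:
  assumes "ordered_basis W bs"
  shows "basis_det bs bs = 1"
proof -
  have "transition_matrix bs bs = 1\<^sub>m (length bs)"
  proof (rule transition_matrix_eqI[OF assms])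
    fix j assume j: "j < length bs"
    have "(\<Sum>l<length bs. 1\<^sub>m (length bs) $$ (l, j) *\<^sub>R bs ! l) =
        (\<Sum>l<length bs. if l = j then bs ! l else 0)"
      using j by (intro sum.cong) auto
    then show "bs ! j = (\<Sum>l<length bs. 1\<^sub>m (length bs) $$ (l, j) *\<^sub>R bs ! l)"
      using j by simp
  qed simp
  then show ?thesis by (simp add: basis_det_def)
qed

lemma basis_det_trans:
  assumes "ordered_basis W bs" "ordered_basis W cs" "ordered_basis W ds"
  shows "basis_det bs ds = basis_det bs cs * basis_det cs ds"
proof -
  let ?m = "length bs" and ?A = "transition_matrix bs cs" and ?B = "transition_matrix cs ds"
  have len: "length cs = ?m" "length ds = ?m"
    using ordered_basis_length_eq assms by blast+
  have carr: "?A \<in> carrier_mat ?m ?m" "?B \<in> carrier_mat ?m ?m"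
    using transition_matrix_carrier[of bs cs] transition_matrix_carrier[of cs ds] len by simp_all
  have "transition_matrix bs ds = ?A * ?B"
  proof (rule transition_matrix_eqI[OF assms(1)])
    show "?A * ?B \<in> carrier_mat ?m ?m" using carr by (rule mult_carrier_mat)
    fix j assume j: "j < ?m"
    have "ds ! j = (\<Sum>i<?m. ?B $$ (i, j) *\<^sub>R cs ! i)"
      using transition_matrix_expand[OF assms(2), of j ds] ordered_basis_nth_in[OF assms(3)] j len
      by simp
    also have "\<dots> = (\<Sum>i<?m. ?B $$ (i, j) *\<^sub>R (\<Sum>l<?m. ?A $$ (l, i) *\<^sub>R bs ! l))"
      using transition_matrix_expand[OF assms(1), of _ cs] ordered_basis_nth_in[OF assms(2)] len
      by (intro sum.cong) auto
    also have "\<dots> = (\<Sum>i<?m. \<Sum>l<?m. (?A $$ (l, i) * ?B $$ (i, j)) *\<^sub>R bs ! l)"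
      by (simp add: scaleR_sum_right mult.commute)
    also have "\<dots> = (\<Sum>l<?m. \<Sum>i<?m. (?A $$ (l, i) * ?B $$ (i, j)) *\<^sub>R bs ! l)"
      by (rule sum.swap)
    also have "\<dots> = (\<Sum>l<?m. (?A * ?B) $$ (l, j) *\<^sub>R bs ! l)"
      using j len
      by (intro sum.cong) (auto simp: scalar_prod_def scaleR_sum_left atLeast0LessThan)
    finally show "ds ! j = (\<Sum>l<?m. (?A * ?B) $$ (l, j) *\<^sub>R bs ! l)" .
  qed
  then show ?thesis using det_mult[OF carr] by (simp add: basis_det_def)
qed

lemma basis_det_inverse:
  assumes "ordered_basis W bs" "ordered_basis W cs"
  shows "basis_det bs cs * basis_det cs bs = 1"
  using basis_det_trans[OF assms assms(1)] basis_det_self[OF assms(1)] by simp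

lemma basis_det_nonzero:
  assumes "ordered_basis W bs" "ordered_basis W cs"
  shows "basis_det bs cs \<noteq> 0"
  using basis_det_inverse[OF assms] by auto

section \<open>Orientations\<close>

lemma equiv_orientation_rel: "equiv {bs. ordered_basis W bs} (orientation_rel W)"
proof (rule equivI)
  show "orientation_rel W \<subseteq> {bs. ordered_basis W bs} \<times> {bs. ordered_basis W bs}"
    by (auto simp: orientation_rel_iff)
  show "refl_on {bs. ordered_basis W bs} (orientation_rel W)"
    by (auto simp: refl_on_def orientation_rel_iff)
  have "basis_det cs bs > 0"
    if "ordered_basis W bs" "ordered_basis W cs" "basis_det bs cs > 0" for bs cs
    using basis_det_inverse[OF that(1,2)] that(3)
    by (intro zero_less_mult_pos[of "basis_det bs cs" "basis_det cs bs"]) simp_all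
  then show "sym (orientation_rel W)"
    by (auto simp: sym_def orientation_rel_iff)
  show "trans (orientation_rel W)"
    unfolding trans_def orientation_rel_iff
    using basis_det_trans by (metis mult_pos_pos)
qed

text \<open>There are only two orientations: since \<^const>\<open>basis_det\<close> is multiplicative along chains,
  two bases that both have negative determinant against a third one are positively related.
  Stated for membership, this is how orientations get adjusted below by changing signs.\<close>

lemma orientation_contains_opposite:
  assumes "X \<in> orientations W" "ordered_basis W bs" "bs \<notin> X"
    "ordered_basis W cs" "basis_det bs cs < 0"
  shows "cs \<in> X"
proof -
  obtain ds where ds: "ordered_basis W ds" "X = orientation_rel W `` {ds}"
    using assms(1) by (auto simp: orientations_def elim: quotientE)
  have "basis_det ds bs \<le> 0" using assms ds by (auto simp: orientation_rel_iff)
  then have "basis_det ds bs < 0"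
    using basis_det_nonzero[OF ds(1) assms(2)] by simp
  then have "basis_det ds cs > 0"
    using basis_det_trans[OF ds(1) assms(2,4)] assms(5) by (simp add: mult_neg_neg)
  then show ?thesis using ds assms by (simp add: orientation_rel_iff)
qed

lemma orientation_eq_class:
  assumes "X \<in> orientations W" "bs \<in> X"
  shows "X = orientation_rel W `` {bs}" "ordered_basis W bs"
proof -
  obtain ds where ds: "X = orientation_rel W `` {ds}"
    using assms(1) by (auto simp: orientations_def elim: quotientE)
  then have r: "(ds, bs) \<in> orientation_rel W" using assms(2) by simp
  then show "ordered_basis W bs" by (simp add: orientation_rel_iff)
  show "X = orientation_rel W `` {bs}"
    using equiv_class_eq[OF equiv_orientation_rel r] ds by simp
qed

lemma oriented_span_eq:
  assumes "ordered_basis W bs"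
  shows "oriented_span bs = (W, orientation_rel W `` {bs})"
  using ordered_basis_finite_span[OF assms] by (simp add: oriented_span_def Let_def)

lemma oriented_span_eq_iff:
  assumes "ordered_basis W bs" "ordered_basis W cs"
  shows "oriented_span bs = oriented_span cs \<longleftrightarrow> basis_det bs cs > 0"
  using assms eq_equiv_class_iff[OF equiv_orientation_rel, of bs W cs]
  by (simp add: oriented_span_eq orientation_rel_iff)

lemma reverse_oriented_span:
  assumes "ordered_basis W bs" "ordered_basis W cs" "basis_det bs cs < 0"
  shows "reverse_orientation (oriented_span bs) = oriented_span cs"
proof -
  have "basis_det cs ds > 0 \<longleftrightarrow> \<not> basis_det bs ds > 0" if "ordered_basis W ds" for ds
    using basis_det_trans[OF assms(1,2) that] assms(3) basis_det_nonzero[OF assms(2) that]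
    by (auto simp: zero_less_mult_iff)
  then show ?thesis
    using assms by (auto simp: reverse_orientation_def oriented_span_eq orientation_rel_iff)
qed

section \<open>Scaling and alternating reversal of lists of vectors\<close>

definition scale :: "(nat \<Rightarrow> real) \<Rightarrow> 'a::real_vector list \<Rightarrow> 'a list" where
  "scale c bs = map (\<lambda>j. c j *\<^sub>R bs ! j) [0..<length bs]"

lemma length_scale [simp]: "length (scale c bs) = length bs"
  by (simp add: scale_def)

lemma nth_scale [simp]: "j < length bs \<Longrightarrow> scale c bs ! j = c j *\<^sub>R bs ! j"
  by (simp add: scale_def)

lemma take_scale: "take i (scale c bs) = scale c (take i bs)"
  by (rule nth_equalityI) auto

lemma drop_scale: "drop i (scale c bs) = scale (\<lambda>j. c (i + j)) (drop i bs)"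
  by (rule nth_equalityI) auto

lemma span_scale_list:
  assumes "\<And>j. j < length bs \<Longrightarrow> c j \<noteq> 0"
  shows "Real_Vector_Spaces.span (set (scale c bs)) = Real_Vector_Spaces.span (set bs)"
proof (rule span_eq[THEN iffD2], intro conjI subsetI)
  fix x assume "x \<in> set (scale c bs)"
  then show "x \<in> Real_Vector_Spaces.span (set bs)"
    by (auto simp: scale_def intro!: Real_Vector_Spaces.span_scale[OF span_base])
next
  fix x assume "x \<in> set bs"
  then obtain j where j: "j < length bs" "x = bs ! j" by (auto simp: in_set_conv_nth)
  have "scale c bs ! j \<in> Real_Vector_Spaces.span (set (scale c bs))"
    using j by (intro span_base nth_mem) simp
  then have "inverse (c j) *\<^sub>R scale c bs ! j \<in> Real_Vector_Spaces.span (set (scale c bs))"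
    by (rule Real_Vector_Spaces.span_scale)
  then show "x \<in> Real_Vector_Spaces.span (set (scale c bs))"
    using j assms by simp
qed

lemma ordered_basis_scale:
  fixes bs :: "'a::euclidean_space list"
  assumes "ordered_basis W bs" "\<And>j. j < length bs \<Longrightarrow> c j \<noteq> 0"
  shows "ordered_basis W (scale c bs)"
  using assms by (intro ordered_basis_if_spanning[OF assms(1)])
    (auto simp: span_scale_list ordered_basis_finite_span)

lemma basis_det_scale:
  assumes "ordered_basis W bs"
  shows "basis_det bs (scale c bs) = (\<Prod>j<length bs. c j)"
proof -
  let ?m = "length bs"
  let ?D = "mat ?m ?m (\<lambda>(l, j). if l = j then c j else 0)"
  have "transition_matrix bs (scale c bs) = ?D"
  proof (rule transition_matrix_eqI[OF assms])
    fix j assume j: "j < ?m"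
    have "(\<Sum>l<?m. ?D $$ (l, j) *\<^sub>R bs ! l) = (\<Sum>l<?m. if l = j then c j *\<^sub>R bs ! l else 0)"
      using j by (intro sum.cong) auto
    then show "scale c bs ! j = (\<Sum>l<?m. ?D $$ (l, j) *\<^sub>R bs ! l)"
      using j by simp
  qed simp
  then have "basis_det bs (scale c bs) = Determinant.det ?D"
    by (simp add: basis_det_def)
  also have "\<dots> = prod_list (diag_mat ?D)"
    by (rule det_upper_triangular[of _ ?m]) auto
  also have "\<dots> = (\<Prod>j<?m. c j)"
    by (simp add: prod_list_diag_prod atLeast0LessThan)
  finally show ?thesis .
qed

text \<open>This is the passage from a basis adapted to \<open>(F1, F2)\<close> to one adapted to \<open>(F2, F1)\<close>.
  It is defined for any real vector space so that it also applies to lists of coordinates and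
  of signs, on which it acts compatibly.\<close>

definition alt_rev :: "'a::real_vector list \<Rightarrow> 'a list" where
  "alt_rev bs = scale (\<lambda>j. (-1) ^ j) (rev bs)"

lemma length_alt_rev [simp]: "length (alt_rev bs) = length bs"
  by (simp add: alt_rev_def)

lemma nth_alt_rev:
  "j < length bs \<Longrightarrow> alt_rev bs ! j = (-1) ^ j *\<^sub>R bs ! (length bs - Suc j)"
  by (simp add: alt_rev_def rev_nth)

lemma ordered_basis_alt_rev:
  fixes bs :: "'a::euclidean_space list"
  assumes "ordered_basis W bs"
  shows "ordered_basis W (alt_rev bs)"
  unfolding alt_rev_def
  by (rule ordered_basis_scale) (use assms in \<open>auto simp: ordered_basis_def\<close>)

text \<open>Expanding along the last column, the only nonzero entry \<open>(-1) ^ m\<close> sits in row \<open>0\<close>, with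
  cofactor sign \<open>(-1) ^ m\<close>; the minor is the same matrix of size \<open>m\<close>.\<close>

lemma det_alternating_antidiagonal:
  "Determinant.det (mat m m (\<lambda>(l, j). if l + Suc j = m then (-1) ^ j else 0) :: real mat) = 1"
proof (induction m)
  case 0
  show ?case by (rule det_dim_zero) simp
next
  case (Suc m)
  let ?R = "\<lambda>m. mat m m (\<lambda>(l, j). if l + Suc j = m then (-1) ^ j else 0) :: real mat"
  have del: "mat_delete (?R (Suc m)) 0 m = ?R m"
    by (rule eq_matI) (auto simp: mat_delete_def)
  have minor: "cofactor (?R (Suc m)) 0 m = (-1) ^ m"
    unfolding cofactor_def del Suc.IH by simp
  have "Determinant.det (?R (Suc m)) =
      (\<Sum>i<Suc m. ?R (Suc m) $$ (i, m) * cofactor (?R (Suc m)) i m)"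
    by (rule laplace_expansion_column) auto
  also have "\<dots> = (\<Sum>i<Suc m. if i = 0 then (-1) ^ m * cofactor (?R (Suc m)) 0 m else 0)"
    by (intro sum.cong) auto
  also have "\<dots> = (-1) ^ m * cofactor (?R (Suc m)) 0 m" by simp
  also have "\<dots> = 1"
    unfolding minor by (simp flip: power_mult_distrib)
  finally show ?case .
qed

text \<open>Reversing \<open>m\<close> vectors has sign \<open>(-1) ^ (m (m - 1) / 2)\<close>, which is also the product of
  the alternating signs; hence \<^const>\<open>alt_rev\<close> preserves orientation in every dimension.\<close>

lemma basis_det_alt_rev:
  assumes "ordered_basis W bs"
  shows "basis_det bs (alt_rev bs) = 1"
proof -
  let ?m = "length bs"
  let ?R = "mat ?m ?m (\<lambda>(l, j). if l + Suc j = ?m then (-1) ^ j else 0) :: real mat"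
  have "transition_matrix bs (alt_rev bs) = ?R"
  proof (rule transition_matrix_eqI[OF assms])
    fix j assume j: "j < ?m"
    have "(\<Sum>l<?m. ?R $$ (l, j) *\<^sub>R bs ! l) =
        (\<Sum>l<?m. if l = ?m - Suc j then (-1) ^ j *\<^sub>R bs ! l else 0)"
      using j by (intro sum.cong) auto
    then show "alt_rev bs ! j = (\<Sum>l<?m. ?R $$ (l, j) *\<^sub>R bs ! l)"
      using j by (cases "length bs") (auto simp: nth_alt_rev)
  qed simp
  then show ?thesis using det_alternating_antidiagonal by (simp add: basis_det_def)
qed

lemma take_alt_rev: "i \<le> length bs \<Longrightarrow> take i (alt_rev bs) = alt_rev (drop (length bs - i) bs)"
  by (rule nth_equalityI) (auto simp: nth_alt_rev)

lemma drop_alt_rev: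
  assumes "i \<le> length bs"
  shows "drop (length bs - i) (alt_rev bs) =
    scale (\<lambda>j. (-1) ^ (length bs - i)) (alt_rev (take i bs))"
proof (rule nth_equalityI)
  fix j assume "j < length (drop (length bs - i) (alt_rev bs))"
  then have "j < i" using assms by simp
  moreover have "((-1) ^ (length bs - i + j) :: real) = (-1) ^ (length bs - i) * (-1) ^ j"
    by (rule power_add)
  moreover have "length bs - Suc (length bs - i + j) = i - Suc j"
    using assms by simp
  ultimately show "drop (length bs - i) (alt_rev bs) ! j =
      scale (\<lambda>j. (-1) ^ (length bs - i)) (alt_rev (take i bs)) ! j"
    using assms by (simp add: nth_alt_rev del: add_diff_assoc2)
qed (use assms in simp)

section \<open>Sign changes\<close>

lemma finite_sign_assignments: "finite (sign_assignments xs)"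
proof (rule finite_subset)
  show "sign_assignments xs \<subseteq> {ss. set ss \<subseteq> {-1, 1} \<and> length ss = length xs}"
    by (fastforce simp: sign_assignments_def in_set_conv_nth)
  show "finite {ss. set ss \<subseteq> {-1, 1 :: real} \<and> length ss = length xs}"
    by (rule finite_lists_length_eq) simp
qed

lemma sign_assignments_nonempty: "sign_assignments xs \<noteq> {}"
proof -
  have "map (\<lambda>x. if x = 0 then 1 else sgn x) xs \<in> sign_assignments xs"
    by (auto simp: sign_assignments_def sgn_if)
  then show ?thesis by auto
qed

lemma sign_changes_scale_const:
  assumes "e \<noteq> 0"
  shows "sign_changes (scale (\<lambda>j. e) ss) = sign_changes ss"
  using assms by (auto simp: sign_changes_def intro!: arg_cong[of _ _ card])

text \<open>The counts only see the signs of the entries, up to one common sign \<open>e\<close>. This is why they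
  are well defined on lines and for adapted bases.\<close>

lemma sign_changes_image_subset:
  assumes "e \<in> {-1, 1}" "length ys = length xs"
    and "\<And>j. j < length xs \<Longrightarrow> sgn (ys ! j) = e * sgn (xs ! j)"
  shows "sign_changes ` sign_assignments ys \<subseteq> sign_changes ` sign_assignments xs"
proof
  fix t assume "t \<in> sign_changes ` sign_assignments ys"
  then obtain ss where ss: "ss \<in> sign_assignments ys" "t = sign_changes ss" by auto
  have "scale (\<lambda>j. e) ss \<in> sign_assignments xs"
    unfolding sign_assignments_def
  proof (intro CollectI conjI allI impI)
    show "length (scale (\<lambda>j. e) ss) = length xs"
      using ss(1) assms(2) by (simp add: sign_assignments_def)
    fix j assume j: "j < length xs"
    then have *: "ss ! j \<in> {-1, 1}" "ys ! j \<noteq> 0 \<Longrightarrow> ss ! j = sgn (ys ! j)" "j < length ss"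
      using ss(1) assms(2) by (auto simp: sign_assignments_def)
    show "scale (\<lambda>j. e) ss ! j \<in> {-1, 1}"
      using * assms(1) by auto
    assume "xs ! j \<noteq> 0"
    moreover from this have "ys ! j \<noteq> 0"
      using assms(1) assms(3)[OF j] by (auto simp: sgn_if split: if_splits)
    ultimately show "scale (\<lambda>j. e) ss ! j = sgn (xs ! j)"
      using * assms(1) assms(3)[OF j] by auto
  qed
  then show "t \<in> sign_changes ` sign_assignments xs"
    using ss(2) sign_changes_scale_const[of e ss] assms(1)
    by (intro image_eqI[of _ _ "scale (\<lambda>j. e) ss"]) auto
qed

lemma sign_changes_image_eq:
  assumes "e \<in> {-1, 1}" "length ys = length xs"
    and "\<And>j. j < length xs \<Longrightarrow> sgn (ys ! j) = e * sgn (xs ! j)"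
  shows "sign_changes ` sign_assignments ys = sign_changes ` sign_assignments xs"
proof
  show "sign_changes ` sign_assignments ys \<subseteq> sign_changes ` sign_assignments xs"
    by (rule sign_changes_image_subset) (use assms in auto)
  show "sign_changes ` sign_assignments xs \<subseteq> sign_changes ` sign_assignments ys"
    by (rule sign_changes_image_subset[of e]) (use assms in auto)
qed

text \<open>Two adjacent entries of \<^term>\<open>alt_rev ss\<close> differ exactly when the corresponding entries
  of \<^term>\<open>ss\<close> agree, so together both sequences have one change at each of the
  \<^term>\<open>length ss - 1\<close> positions.\<close>

lemma sign_changes_alt_rev:
  assumes "set ss \<subseteq> {-1, 1}"
  shows "sign_changes (alt_rev ss) + sign_changes ss = length ss - 1"
proof -
  let ?m = "length ss"
  let ?C = "{j. Suc j < ?m \<and> ss ! j \<noteq> ss ! Suc j}"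
  let ?A = "{j. Suc j < ?m \<and> ss ! j = ss ! Suc j}"
  let ?D = "{j. Suc j < ?m \<and> alt_rev ss ! j \<noteq> alt_rev ss ! Suc j}"
  have flip: "alt_rev ss ! j \<noteq> alt_rev ss ! Suc j \<longleftrightarrow> ss ! (?m - 2 - j) = ss ! Suc (?m - 2 - j)"
    if "Suc j < ?m" for j
  proof -
    have idx: "?m - Suc j = Suc (?m - 2 - j)" "?m - Suc (Suc j) = ?m - 2 - j"
      using that by auto
    have "ss ! i \<in> {-1, 1}" if "i < ?m" for i
      using assms nth_mem[OF that] by (rule subsetD)
    from this[of "?m - 2 - j"] this[of "Suc (?m - 2 - j)"] that
    have "ss ! (?m - 2 - j) \<in> {-1, 1}" "ss ! Suc (?m - 2 - j) \<in> {-1, 1}"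
      by simp_all
    then show ?thesis using that unfolding nth_alt_rev[OF that] nth_alt_rev[OF Suc_lessD[OF that]] idx
      by auto
  qed
  have "bij_betw (\<lambda>j. ?m - 2 - j) ?D ?A"
  proof (rule bij_betw_byWitness[where f' = "\<lambda>j. ?m - 2 - j"])
    show "(\<lambda>j. ?m - 2 - j) ` ?D \<subseteq> ?A"
    proof (rule image_subsetI)
      fix j assume "j \<in> ?D"
      then have "Suc j < ?m" "alt_rev ss ! j \<noteq> alt_rev ss ! Suc j" by simp_all
      with flip[of j] show "?m - 2 - j \<in> ?A" by simp
    qed
    show "(\<lambda>j. ?m - 2 - j) ` ?A \<subseteq> ?D"
    proof (rule image_subsetI)
      fix j assume "j \<in> ?A"
      then have j: "Suc j < ?m" "ss ! j = ss ! Suc j" by simp_all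
      have "Suc (?m - 2 - j) < ?m" "?m - 2 - (?m - 2 - j) = j" using j(1) by simp_all
      with flip[of "?m - 2 - j"] j(2) show "?m - 2 - j \<in> ?D" by simp
    qed
  qed auto
  then have "card ?D = card ?A" by (rule bij_betw_same_card)
  moreover have "card ?A + card ?C = card (?A \<union> ?C)"
    by (rule card_Un_disjoint[symmetric]) (auto intro: finite_subset[of _ "{..<?m}"])
  moreover have "?A \<union> ?C = {..<?m - 1}" by auto
  ultimately show ?thesis by (simp add: sign_changes_def)
qed

lemma set_sign_assignment: "ss \<in> sign_assignments xs \<Longrightarrow> set ss \<subseteq> {-1, 1}"
  by (fastforce simp: sign_assignments_def in_set_conv_nth)

lemma alt_rev_sign_assignment:
  assumes "ss \<in> sign_assignments xs"
  shows "alt_rev ss \<in> sign_assignments (alt_rev xs)"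
proof -
  have len: "length ss = length xs" using assms by (simp add: sign_assignments_def)
  have "alt_rev ss ! j \<in> {-1, 1} \<and>
      (alt_rev xs ! j \<noteq> 0 \<longrightarrow> alt_rev ss ! j = sgn (alt_rev xs ! j))" if "j < length xs" for j
  proof -
    let ?i = "length xs - Suc j"
    have "ss ! ?i \<in> {-1, 1}" "xs ! ?i \<noteq> 0 \<Longrightarrow> ss ! ?i = sgn (xs ! ?i)"
      using assms that by (auto simp: sign_assignments_def)
    then show ?thesis
      using that len by (cases "even j") (auto simp: nth_alt_rev sgn_minus)
  qed
  then show ?thesis by (auto simp: sign_assignments_def len)
qed

lemma alt_rev_alt_rev: "alt_rev (alt_rev bs) = scale (\<lambda>j. (-1) ^ (length bs - 1)) bs"
proof (rule nth_equalityI)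
  fix j assume "j < length (alt_rev (alt_rev bs))"
  then have j: "j < length bs" by simp
  have "((-1) ^ j * (-1) ^ (length bs - Suc j) :: real) = (-1) ^ (length bs - 1)"
    unfolding power_add[symmetric] using j by simp
  then show "alt_rev (alt_rev bs) ! j = scale (\<lambda>j. (-1) ^ (length bs - 1)) bs ! j"
    using j by (simp add: nth_alt_rev)
qed simp

lemma sign_changes_image_alt_rev:
  "sign_changes ` sign_assignments (alt_rev xs) =
     (\<lambda>t. length xs - 1 - t) ` sign_changes ` sign_assignments xs"
proof (intro equalityI subsetI)
  fix t assume "t \<in> (\<lambda>t. length xs - 1 - t) ` sign_changes ` sign_assignments xs"
  then obtain ss where ss: "ss \<in> sign_assignments xs" "t = length xs - 1 - sign_changes ss"
    by auto
  then have "length ss = length xs" by (simp add: sign_assignments_def)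
  with ss sign_changes_alt_rev[OF set_sign_assignment[OF ss(1)]] have "t = sign_changes (alt_rev ss)"
    by simp
  then show "t \<in> sign_changes ` sign_assignments (alt_rev xs)"
    using alt_rev_sign_assignment[OF ss(1)] by simp
next
  fix t assume "t \<in> sign_changes ` sign_assignments (alt_rev xs)"
  then obtain ss where ss: "ss \<in> sign_assignments (alt_rev xs)" "t = sign_changes ss" by auto
  then have len: "length ss = length xs" by (simp add: sign_assignments_def)
  \<comment> \<open>Applying \<^const>\<open>alt_rev\<close> twice only changes a global sign, which no count notices.\<close>
  have "sign_changes ` sign_assignments (alt_rev (alt_rev xs)) =
      sign_changes ` sign_assignments xs"
    by (rule sign_changes_image_eq[of "(-1) ^ (length xs - 1)"])
      (auto simp: alt_rev_alt_rev sgn_mult minus_one_power_iff)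
  then have "sign_changes (alt_rev ss) \<in> sign_changes ` sign_assignments xs"
    using alt_rev_sign_assignment[OF ss(1)] by blast
  moreover have "t = length xs - 1 - sign_changes (alt_rev ss)"
    using sign_changes_alt_rev[OF set_sign_assignment[OF ss(1)]] len ss(2) by simp
  ultimately show "t \<in> (\<lambda>t. length xs - 1 - t) ` sign_changes ` sign_assignments xs"
    by blast
qed

text \<open>Hence few sign changes on one side mean many on the other, and a minimum over the sign
  assignments turns into a maximum. This duality is the combinatorial core of the theorem.\<close>

lemma Min_alt_rev_plus_Max_sign_changes:
  "Min (sign_changes ` sign_assignments (alt_rev xs)) +
     Max (sign_changes ` sign_assignments xs) = length xs - 1"
proof -
  let ?A = "sign_changes ` sign_assignments xs"
  have A: "finite ?A" "?A \<noteq> {}"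
    using finite_sign_assignments sign_assignments_nonempty by auto
  have bound: "t \<le> length xs - 1" if "t \<in> ?A" for t
  proof -
    obtain ss where ss: "ss \<in> sign_assignments xs" "t = sign_changes ss" using \<open>t \<in> ?A\<close> by auto
    then have "length ss = length xs" by (simp add: sign_assignments_def)
    then show ?thesis using sign_changes_alt_rev[OF set_sign_assignment[OF ss(1)]] ss(2) by simp
  qed
  have "Min ((\<lambda>t. length xs - 1 - t) ` ?A) = length xs - 1 - Max ?A"
    using A by (intro Min_eqI) (auto intro!: diff_le_mono2)
  then show ?thesis
    using bound[OF Max_in[OF A]] by (simp add: sign_changes_image_alt_rev)
qed

section \<open>Sign changes of coordinates\<close>

lemma coordinates_scale_vector:
  assumes "ordered_basis W bs" "v \<in> W"
  shows "coordinates bs (a *\<^sub>R v) = scale (\<lambda>j. a) (coordinates bs v)"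
proof (rule coordinates_eqI[OF assms(1)])
  have "(\<Sum>l<length bs. scale (\<lambda>j. a) (coordinates bs v) ! l *\<^sub>R bs ! l) =
      a *\<^sub>R (\<Sum>l<length bs. coordinates bs v ! l *\<^sub>R bs ! l)"
    unfolding scaleR_sum_right by (intro sum.cong) auto
  then show "(\<Sum>l<length bs. scale (\<lambda>j. a) (coordinates bs v) ! l *\<^sub>R bs ! l) = a *\<^sub>R v"
    using sum_coordinates[OF assms] by simp
qed simp

lemma coordinates_scale_basis:
  fixes bs :: "'a::euclidean_space list"
  assumes "ordered_basis W bs" "v \<in> W" "\<And>j. j < length bs \<Longrightarrow> c j \<noteq> 0"
  shows "coordinates (scale c bs) v = scale (\<lambda>j. inverse (c j)) (coordinates bs v)"
proof (rule coordinates_eqI[OF ordered_basis_scale[OF assms(1,3)]])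
  have "(\<Sum>l<length (scale c bs).
        scale (\<lambda>j. inverse (c j)) (coordinates bs v) ! l *\<^sub>R scale c bs ! l) =
      (\<Sum>l<length bs. coordinates bs v ! l *\<^sub>R bs ! l)"
    using assms(3) by (intro sum.cong) auto
  then show "(\<Sum>l<length (scale c bs).
      scale (\<lambda>j. inverse (c j)) (coordinates bs v) ! l *\<^sub>R scale c bs ! l) = v"
    using sum_coordinates[OF assms(1,2)] by simp
qed simp_all

lemma coordinates_alt_rev:
  fixes bs :: "'a::euclidean_space list"
  assumes "ordered_basis W bs" "v \<in> W"
  shows "coordinates (alt_rev bs) v = alt_rev (coordinates bs v)"
proof (rule coordinates_eqI[OF ordered_basis_alt_rev[OF assms(1)]])
  let ?g = "\<lambda>l. coordinates bs v ! l *\<^sub>R bs ! l"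
  have "(\<Sum>l<length (alt_rev bs). alt_rev (coordinates bs v) ! l *\<^sub>R alt_rev bs ! l) =
      (\<Sum>l<length bs. ?g (length bs - Suc l))"
    by (intro sum.cong) (auto simp: nth_alt_rev simp flip: power_mult_distrib)
  also have "\<dots> = (\<Sum>l<length bs. ?g l)" by (rule sum.nat_diff_reindex)
  also have "\<dots> = v" by (rule sum_coordinates[OF assms])
  finally show "(\<Sum>l<length (alt_rev bs). alt_rev (coordinates bs v) ! l *\<^sub>R alt_rev bs ! l) = v" .
qed simp

lemma S_plus_scale_vector:
  assumes "ordered_basis W bs" "v \<in> W" "a \<noteq> 0"
  shows "S_plus bs (a *\<^sub>R v) = S_plus bs v"
  unfolding S_plus_def coordinates_scale_vector[OF assms(1,2)]
  by (intro arg_cong[of _ _ Max] sign_changes_image_eq[of "sgn a"])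
    (use assms(3) in \<open>simp_all add: sgn_mult, simp add: sgn_if\<close>)

lemma S_minus_scale_basis:
  fixes bs :: "'a::euclidean_space list"
  assumes "ordered_basis W bs" "v \<in> W" "e \<in> {-1, 1}"
    "\<And>j. j < length bs \<Longrightarrow> e * c j > 0"
  shows "S_minus (scale c bs) v = S_minus bs v"
proof -
  have c: "c j \<noteq> 0" "sgn (c j) = e" if "j < length bs" for j
    using assms(3) assms(4)[OF that] by (auto simp: sgn_if)
  have coords: "coordinates (scale c bs) v = scale (\<lambda>j. inverse (c j)) (coordinates bs v)"
    using c(1) by (rule coordinates_scale_basis[OF assms(1,2)])
  show ?thesis
    unfolding S_minus_def coords
    by (intro arg_cong[of _ _ Min] sign_changes_image_eq[OF assms(3)])
      (use assms(3) in \<open>auto simp: sgn_mult c(2)\<close>)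
qed

lemma S_minus_alt_rev:
  fixes bs :: "'a::euclidean_space list"
  assumes "ordered_basis W bs" "v \<in> W"
  shows "S_minus (alt_rev bs) v + S_plus bs v = length bs - 1"
  using Min_alt_rev_plus_Max_sign_changes[of "coordinates bs v"]
  by (simp add: S_minus_def S_plus_def coordinates_alt_rev[OF assms])

section \<open>Flags spanned by a basis\<close>

lemma ordered_basis_sublist:
  assumes "distinct bs" "Real_Vector_Spaces.independent (set bs)" "distinct cs" "set cs \<subseteq> set bs"
  shows "ordered_basis (Real_Vector_Spaces.span (set cs)) cs"
  using assms(3) independent_mono[OF assms(2,4)] by (simp add: ordered_basis_def)

lemma ordered_basis_take:
  "ordered_basis W bs \<Longrightarrow> ordered_basis (Real_Vector_Spaces.span (set (take i bs))) (take i bs)"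
  by (rule ordered_basis_sublist[of bs]) (auto simp: ordered_basis_def dest: in_set_takeD)

lemma ordered_basis_drop:
  "ordered_basis W bs \<Longrightarrow> ordered_basis (Real_Vector_Spaces.span (set (drop i bs))) (drop i bs)"
  by (rule ordered_basis_sublist[of bs]) (auto simp: ordered_basis_def dest: in_set_dropD)

lemma orientation_class_in_orientations:
  "ordered_basis W bs \<Longrightarrow> orientation_rel W `` {bs} \<in> orientations W"
  unfolding orientations_def by (rule quotientI) simp

lemma oriented_span_lift_in_flag_lifts:
  fixes f :: "nat \<Rightarrow> (real ^ 'n::finite) list"
  assumes "\<And>i. i \<in> {1..<CARD('n)} \<Longrightarrow> ordered_basis (Real_Vector_Spaces.span (set (f i))) (f i)"
    and "\<And>i. i \<in> {1..<CARD('n)} \<Longrightarrow> length (f i) = i"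
    and "\<And>i j. i \<le> j \<Longrightarrow> set (f i) \<subseteq> set (f j)"
  shows "(\<lambda>i\<in>{1..<CARD('n)}. oriented_span (f i)) \<in> flag_lifts"
proof -
  have "dim (set (f i)) = i" if "i \<in> {1..<CARD('n)}" for i
    using ordered_basis_finite_span(4)[OF assms(1)[OF that]] assms(2)[OF that] by simp
  then show ?thesis
    using assms(1) span_mono[OF assms(3)] unfolding flag_lifts_def
    by (auto simp: oriented_span_def Let_def intro!: orientation_class_in_orientations
        simp del: atLeastLessThan_iff)
qed

lemma orientation_subset: "X \<in> orientations W \<Longrightarrow> X \<subseteq> {bs. ordered_basis W bs}"
  using orientation_eq_class(2) by blast

text \<open>This makes \<^const>\<open>lift_rel\<close> symmetric and transitive.\<close>

lemma reverse_odd_involution: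
  fixes L :: "'n::finite lift"
  assumes "L \<in> flag_lifts"
  shows "reverse_odd (reverse_odd L) = L"
proof
  fix i
  show "reverse_odd (reverse_odd L) i = L i"
  proof (cases "i \<in> {1..<CARD('n)}")
    case True
    then have "snd (L i) \<subseteq> {bs. ordered_basis (fst (L i)) bs}"
      using assms by (intro orientation_subset) (auto simp: flag_lifts_def)
    then have "{bs. ordered_basis (fst (L i)) bs} - ({bs. ordered_basis (fst (L i)) bs} - snd (L i))
        = snd (L i)" by blast
    with True show ?thesis
      by (simp add: reverse_odd_def reverse_orientation_def)
  next
    case False
    with assms have "L i = undefined"
      by (auto simp: flag_lifts_def extensional_def)
    with False show ?thesis by (auto simp: reverse_odd_def)
  qed
qed

lemma equiv_lift_rel: "equiv flag_lifts lift_rel"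
  by (rule equivI)
    (auto simp: lift_rel_def refl_on_def sym_def trans_def reverse_odd_involution)

lemma Flag_plus_eq_class:
  assumes "F \<in> Flag_plus" "L \<in> F"
  shows "L \<in> flag_lifts" "F = lift_rel `` {L}"
proof -
  obtain L0 where L0: "F = lift_rel `` {L0}"
    using assms(1) by (auto simp: Flag_plus_def elim: quotientE)
  with assms(2) have r: "(L0, L) \<in> lift_rel" by simp
  then show "L \<in> flag_lifts" by (simp add: lift_rel_def)
  show "F = lift_rel `` {L}"
    using equiv_class_eq[OF equiv_lift_rel r] L0 by simp
qed

lemma take_lift_in_flag_lifts:
  fixes E :: "(real ^ 'n::finite) list"
  assumes "ordered_basis UNIV E"
  shows "(\<lambda>i\<in>{1..<CARD('n)}. oriented_span (take i E)) \<in> flag_lifts"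
  using ordered_basis_finite_span(4)[OF assms]
  by (intro oriented_span_lift_in_flag_lifts ordered_basis_take[OF assms] set_take_subset_set_take)
    (auto simp: dim_UNIV)

lemma drop_lift_in_flag_lifts:
  fixes E :: "(real ^ 'n::finite) list"
  assumes "ordered_basis UNIV E"
  shows "(\<lambda>i\<in>{1..<CARD('n)}. oriented_span (drop (CARD('n) - i) E)) \<in> flag_lifts"
  using ordered_basis_finite_span(4)[OF assms]
  by (intro oriented_span_lift_in_flag_lifts ordered_basis_drop[OF assms] set_drop_subset_set_drop)
    (auto simp: dim_UNIV)

lemma ordered_basis_standard_basis:
  "ordered_basis UNIV (standard_basis :: (real ^ 'n::{finite,linorder}) list)"
proof -
  have set: "set (standard_basis :: (real ^ 'n::{finite,linorder}) list) = Basis"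
    by (auto simp: standard_basis_def Basis_vec_def)
  have "distinct (standard_basis :: (real ^ 'n::{finite,linorder}) list)"
    by (auto simp: standard_basis_def distinct_map inj_on_def axis_eq_axis)
  then show ?thesis
    by (simp add: ordered_basis_def set independent_Basis)
qed

lemma standard_orientation: "snd standard_space \<in> orientations UNIV"
  by (simp add: standard_space_def orientation_class_in_orientations ordered_basis_standard_basis)

lemma adapted_ordered_basis:
  assumes "adapted E F1 F2"
  shows "ordered_basis UNIV E"
  using orientation_eq_class(2)[OF standard_orientation] assms by (auto simp: adapted_def)

lemma adapted_length:
  fixes E :: "(real ^ 'n::{finite,linorder}) list"
  assumes "adapted E F1 F2"
  shows "length E = CARD('n)"
  using ordered_basis_finite_span(4)[OF adapted_ordered_basis[OF assms]] by (simp add: dim_UNIV)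

section \<open>The opposite adapted basis\<close>

text \<open>The initial segments of \<^term>\<open>alt_rev E\<close> are the images under \<^const>\<open>alt_rev\<close> of the final
  segments of \<open>E\<close> and have their orientation. Its final segment of length \<open>i\<close> comes in the same
  way from the initial segment of \<open>E\<close>, but with all \<open>i\<close> vectors multiplied by \<open>(-1) ^ (n - i)\<close>,
  which is \<open>(-1) ^ i\<close> as \<open>n\<close> is even. This reverses exactly the orientations of odd dimension
  and so gives another lift of the same flag.\<close>

lemma adapted_alt_rev:
  fixes E :: "(real ^ 'n::{finite,linorder}) list"
  assumes "even CARD('n)" "adapted E F1 F2"
  shows "adapted (alt_rev E) F2 F1"
proof -
  note b = adapted_ordered_basis[OF assms(2)] and len = adapted_length[OF assms(2)]
  note b' = ordered_basis_alt_rev[OF b]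
  have F: "E \<in> snd standard_space"
    "F1 = lift_rel `` {\<lambda>i\<in>{1..<CARD('n)}. oriented_span (take i E)}"
    "F2 = lift_rel `` {\<lambda>i\<in>{1..<CARD('n)}. oriented_span (drop (CARD('n) - i) E)}"
    using assms(2) by (auto simp: adapted_def)
  have "alt_rev E \<in> orientation_rel UNIV `` {E}"
    using b b' by (simp add: orientation_rel_iff basis_det_alt_rev)
  then have std: "alt_rev E \<in> snd standard_space"
    using orientation_eq_class(1)[OF standard_orientation F(1)] by simp
  have "oriented_span (take i (alt_rev E)) = oriented_span (drop (CARD('n) - i) E)"
    if "i \<in> {1..<CARD('n)}" for i
  proof -
    note bd = ordered_basis_drop[OF b, of "CARD('n) - i"]
    show ?thesis
      using that len oriented_span_eq_iff[OF bd ordered_basis_alt_rev[OF bd]] basis_det_alt_rev[OF bd]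
      by (simp add: take_alt_rev)
  qed
  then have F2: "(\<lambda>i\<in>{1..<CARD('n)}. oriented_span (take i (alt_rev E))) =
      (\<lambda>i\<in>{1..<CARD('n)}. oriented_span (drop (CARD('n) - i) E))"
    by (auto simp: restrict_def)
  have "oriented_span (drop (CARD('n) - i) (alt_rev E)) =
      (if odd i then reverse_orientation (oriented_span (take i E)) else oriented_span (take i E))"
    if i: "i \<in> {1..<CARD('n)}" for i
  proof -
    let ?e = "(-1) ^ (CARD('n) - i) :: real"
    let ?b = "take i E"
    have e: "?e = (-1) ^ i" using assms(1) i by (simp add: minus_one_power_iff)
    have eq: "drop (CARD('n) - i) (alt_rev E) = scale (\<lambda>j. ?e) (alt_rev ?b)"
      using drop_alt_rev[of i E] i len by simp
    note bt = ordered_basis_take[OF b, of i]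
    note ba = ordered_basis_alt_rev[OF bt]
    have bs: "ordered_basis (Real_Vector_Spaces.span (set ?b)) (scale (\<lambda>j. ?e) (alt_rev ?b))"
      by (rule ordered_basis_scale[OF ba]) simp
    have "basis_det ?b (scale (\<lambda>j. ?e) (alt_rev ?b)) = ?e ^ i"
      using basis_det_trans[OF bt ba bs] basis_det_alt_rev[OF bt] basis_det_scale[OF ba, of "\<lambda>j. ?e"]
        i len by simp
    also have "\<dots> = (-1) ^ i" unfolding e by (simp add: minus_one_power_iff)
    finally have det: "basis_det ?b (scale (\<lambda>j. ?e) (alt_rev ?b)) = (-1) ^ i" .
    show ?thesis
    proof (cases "odd i")
      case True
      then show ?thesis
        unfolding eq using reverse_oriented_span[OF bt bs] det by simp
    next
      case False
      then show ?thesis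
        unfolding eq using oriented_span_eq_iff[OF bt bs] det by simp
    qed
  qed
  then have "(\<lambda>i\<in>{1..<CARD('n)}. oriented_span (drop (CARD('n) - i) (alt_rev E))) =
      reverse_odd (\<lambda>i\<in>{1..<CARD('n)}. oriented_span (take i E))"
    by (auto simp: reverse_odd_def restrict_def)
  then have "(\<lambda>i\<in>{1..<CARD('n)}. oriented_span (take i E),
      \<lambda>i\<in>{1..<CARD('n)}. oriented_span (drop (CARD('n) - i) (alt_rev E))) \<in> lift_rel"
    using take_lift_in_flag_lifts[OF b] drop_lift_in_flag_lifts[OF b'] by (simp add: lift_rel_def)
  from equiv_class_eq[OF equiv_lift_rel this] std F(2,3) F2
  show ?thesis by (simp add: adapted_def)
qed

section \<open>Uniqueness of adapted bases\<close>

lemma span_take_Int_span_drop: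
  assumes "ordered_basis W E" "j < length E"
    "v \<in> Real_Vector_Spaces.span (set (take (Suc j) E))" "v \<in> Real_Vector_Spaces.span (set (drop j E))"
  shows "v = coordinates E v ! j *\<^sub>R E ! j"
proof -
  note b = ordered_basis_finite_span[OF assms(1)]
  have "v \<in> W"
    using assms(3) span_mono[OF set_take_subset] b(3) by blast
  have zero: "coordinates E v ! l = 0" if l: "l < length E" "l \<noteq> j" for l
  proof (rule ccontr)
    assume "coordinates E v ! l \<noteq> 0"
    then have ne: "representation (set E) v (E ! l) \<noteq> 0" using l by (simp add: coordinates_def)
    have "representation (set (take (Suc j) E)) v (E ! l) \<noteq> 0"
      using ne representation_extend[OF b(2) assms(3) set_take_subset] by simp
    then have "E ! l \<in> set (take (Suc j) E)" by (rule representation_ne_zero)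
    then have "l \<le> j" using b(1) l assms(2)
      by (auto simp: in_set_conv_nth nth_eq_iff_index_eq)
    have "representation (set (drop j E)) v (E ! l) \<noteq> 0"
      using ne representation_extend[OF b(2) assms(4) set_drop_subset] by simp
    then have "E ! l \<in> set (drop j E)" by (rule representation_ne_zero)
    then have "j \<le> l" using b(1) l assms(2)
      by (auto simp: in_set_conv_nth nth_eq_iff_index_eq)
    with \<open>l \<le> j\<close> l show False by simp
  qed
  have "v = (\<Sum>l<length E. coordinates E v ! l *\<^sub>R E ! l)"
    using sum_coordinates[OF assms(1) \<open>v \<in> W\<close>] by simp
  also have "\<dots> = (\<Sum>l<length E. if l = j then coordinates E v ! l *\<^sub>R E ! l else 0)"
    using zero by (intro sum.cong) auto
  also have "\<dots> = coordinates E v ! j *\<^sub>R E ! j" using assms(2) by simp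
  finally show ?thesis .
qed

text \<open>The quotient of two consecutive partial products has the sign of \<open>e\<close>.\<close>

lemma factors_constant_sign:
  fixes c :: "nat \<Rightarrow> real"
  assumes "e \<in> {-1, 1}" "\<And>i. i \<le> n \<Longrightarrow> e ^ i * (\<Prod>j<i. c j) > 0" "j < n"
  shows "e * c j > 0"
proof -
  have "(e ^ j * (\<Prod>j<j. c j)) * (e * c j) > 0"
    using assms(2)[of "Suc j"] assms(3) by (simp add: mult_ac)
  moreover have "e ^ j * (\<Prod>j<j. c j) > 0" using assms(2,3) by simp
  ultimately show ?thesis by (rule zero_less_mult_pos)
qed

lemma fst_reverse_odd:
  "i \<in> {1..<CARD('n)} \<Longrightarrow> fst (reverse_odd L i) = fst (L i)" for L :: "'n::finite lift"
  by (simp add: reverse_odd_def reverse_orientation_def)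

text \<open>The underlying flags already determine the line of each basis vector, as the intersection
  of an initial with a final span. The orientations of the first flag and of the whole space fix
  the signs of the scaling factors up to a common sign \<open>e\<close>.\<close>

lemma adapted_unique:
  fixes E D :: "(real ^ 'n::{finite,linorder}) list"
  assumes even: "even CARD('n)" and E: "adapted E F1 F2" and D: "adapted D F1 F2"
  obtains c e where "D = scale c E" "e \<in> {-1, 1 :: real}" "\<And>j. j < CARD('n) \<Longrightarrow> e * c j > 0"
proof -
  let ?n = "CARD('n)"
  let ?L = "\<lambda>E :: (real ^ 'n::{finite,linorder}) list. \<lambda>i\<in>{1..<?n}. oriented_span (take i E)"
  let ?R = "\<lambda>E :: (real ^ 'n::{finite,linorder}) list. \<lambda>i\<in>{1..<?n}. oriented_span (drop (?n - i) E)"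
  note bE = adapted_ordered_basis[OF E] and bD = adapted_ordered_basis[OF D]
  note lenE = adapted_length[OF E] and lenD = adapted_length[OF D]
  have std: "E \<in> snd standard_space" "D \<in> snd standard_space"
    and cls: "lift_rel `` {?L E} = lift_rel `` {?L D}" "lift_rel `` {?R E} = lift_rel `` {?R D}"
    using E D by (auto simp: adapted_def)
  have "(?L E, ?L D) \<in> lift_rel"
    by (rule eq_equiv_class[OF cls(1) equiv_lift_rel take_lift_in_flag_lifts[OF bD]])
  then have L_cases: "?L D = ?L E \<or> ?L D = reverse_odd (?L E)"
    by (simp add: lift_rel_def)
  have "(?R E, ?R D) \<in> lift_rel"
    by (rule eq_equiv_class[OF cls(2) equiv_lift_rel drop_lift_in_flag_lifts[OF bD]])
  then have R_cases: "?R D = ?R E \<or> ?R D = reverse_odd (?R E)"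
    by (simp add: lift_rel_def)
  have span_take: "Real_Vector_Spaces.span (set (take i D)) = Real_Vector_Spaces.span (set (take i E))"
    if "i \<le> ?n" for i
  proof -
    consider "i = 0" | "i \<in> {1..<?n}" | "i = ?n" using \<open>i \<le> ?n\<close> by force
    then show ?thesis
    proof cases
      case 2
      have "fst (?L D i) = fst (?L E i)"
        using L_cases fst_reverse_odd[OF 2, of "?L E"] by (elim disjE) (simp_all only:)
      with 2 show ?thesis by (simp add: oriented_span_def Let_def)
    qed (use bE bD lenE lenD in \<open>auto simp: ordered_basis_def\<close>)
  qed
  have span_drop: "Real_Vector_Spaces.span (set (drop j D)) = Real_Vector_Spaces.span (set (drop j E))"
    if "j < ?n" for j
  proof (cases "j = 0")
    case True
    then show ?thesis using bE bD by (simp add: ordered_basis_def)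
  next
    case False
    then have 2: "?n - j \<in> {1..<?n}" and [simp]: "?n - (?n - j) = j" using that by auto
    have "fst (?R D (?n - j)) = fst (?R E (?n - j))"
      using R_cases fst_reverse_odd[OF 2, of "?R E"] by (elim disjE) (simp_all only:)
    with 2 show ?thesis by (simp add: oriented_span_def Let_def)
  qed
  define c where "c j = coordinates E (D ! j) ! j" for j
  have D_eq: "D = scale c E"
  proof (rule nth_equalityI)
    fix j assume j: "j < length D"
    have "D ! j \<in> set (take (Suc j) D)"
      using j by (simp add: take_Suc_conv_app_nth)
    moreover have "D ! j \<in> set (drop j D)"
      using j by (simp flip: Cons_nth_drop_Suc)
    ultimately have "D ! j = c j *\<^sub>R E ! j"
      unfolding c_def using j lenD lenE
      by (intro span_take_Int_span_drop[OF bE])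
        (auto simp flip: span_take span_drop intro: span_base)
    then show "D ! j = scale c E ! j" using j lenD lenE by simp
  qed (simp add: lenD lenE)
  have det_take: "basis_det (take i E) (take i D) = (\<Prod>j<i. c j)" if "i \<le> ?n" for i
    using basis_det_scale[OF ordered_basis_take[OF bE], of i c] that lenE
    by (simp add: D_eq take_scale)
  have bD': "ordered_basis (Real_Vector_Spaces.span (set (take i E))) (take i D)" if "i \<le> ?n" for i
    using ordered_basis_take[OF bD, of i] span_take[OF that] by simp
  have "D \<in> orientation_rel UNIV `` {E}"
    using orientation_eq_class(1)[OF standard_orientation std(1)] std(2) by simp
  then have last: "(\<Prod>j<?n. c j) > 0"
    using det_take[of ?n] lenE lenD by (simp add: orientation_rel_iff)
  \<comment> \<open>The two lifts of the first flag agree up to reversing all odd dimensions, so the partial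
    products of the scaling factors are all positive or alternate in sign.\<close>
  obtain e :: real where e: "e \<in> {-1, 1}" "\<And>i. i \<in> {1..<?n} \<Longrightarrow> e ^ i * (\<Prod>j<i. c j) > 0"
  proof -
    from L_cases show thesis
    proof
      assume eq: "?L D = ?L E"
      have "(1::real) ^ i * (\<Prod>j<i. c j) > 0" if i: "i \<in> {1..<?n}" for i
      proof -
        have "oriented_span (take i E) = oriented_span (take i D)"
          using fun_cong[OF eq, of i] i by simp
        then show ?thesis
          using oriented_span_eq_iff[OF ordered_basis_take[OF bE] bD', of i] det_take[of i] i by simp
      qed
      then show thesis by (intro that[of 1]) auto
    next
      assume eq: "?L D = reverse_odd (?L E)"
      have "(-1::real) ^ i * (\<Prod>j<i. c j) > 0" if i: "i \<in> {1..<?n}" for i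
      proof (cases "odd i")
        case True
        have "reverse_orientation (oriented_span (take i E)) = oriented_span (take i D)"
          using fun_cong[OF eq, of i] i True by (simp add: reverse_odd_def)
        moreover have "take i D \<in> snd (oriented_span (take i D))"
          using ordered_basis_take[OF bD, of i]
          by (simp add: oriented_span_def Let_def orientation_rel_iff)
        ultimately have "take i D \<notin> snd (oriented_span (take i E))"
          by (metis DiffD2 reverse_orientation_def snd_conv)
        then have "\<not> basis_det (take i E) (take i D) > 0"
          using ordered_basis_take[OF bE, of i] bD'[of i] i
          by (simp add: oriented_span_def Let_def orientation_rel_iff)
        then have "basis_det (take i E) (take i D) < 0"
          using basis_det_nonzero[OF ordered_basis_take[OF bE, of i] bD'] i by simp
        with det_take[of i] i True show ?thesis by simp
      next
        case False
        have "oriented_span (take i E) = oriented_span (take i D)"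
          using fun_cong[OF eq, of i] i False by (simp add: reverse_odd_def)
        then show ?thesis
          using oriented_span_eq_iff[OF ordered_basis_take[OF bE] bD', of i] det_take[of i] i False
          by simp
      qed
      then show thesis by (intro that[of "-1"]) auto
    qed
  qed
  have "e ^ i * (\<Prod>j<i. c j) > 0" if "i \<le> ?n" for i
  proof -
    consider "i = 0" | "i \<in> {1..<?n}" | "i = ?n" using \<open>i \<le> ?n\<close> by force
    then show ?thesis
    proof cases
      case 3
      have "e ^ ?n = 1" using e(1) even by auto
      then show ?thesis using last 3 by simp
    qed (use e in auto)
  qed
  then have "e * c j > 0" if "j < ?n" for j
    using factors_constant_sign[OF e(1)] that by blast
  then show thesis using that D_eq e(1) by blast
qed

section \<open>Existence of adapted bases\<close>

text \<open>The space \<open>V (j + 1) \<inter> W (n - j)\<close> contains a nonzero vector because the dimensions add up to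
  \<open>n + 1\<close>. Such vectors form a basis: transversality keeps each of them out of the preceding
  \<open>V j\<close>. That the final segments span the spaces \<open>W\<close> then follows by counting dimensions.\<close>

lemma transverse_flags_adapted_lines:
  fixes V W :: "nat \<Rightarrow> ('a::euclidean_space) set"
  assumes V: "\<And>i. i \<le> DIM('a) \<Longrightarrow> subspace (V i) \<and> dim (V i) = i"
    and W: "\<And>i. i \<le> DIM('a) \<Longrightarrow> subspace (W i) \<and> dim (W i) = i"
    and V_mono: "\<And>i j. i \<le> j \<Longrightarrow> j \<le> DIM('a) \<Longrightarrow> V i \<subseteq> V j"
    and W_mono: "\<And>i j. i \<le> j \<Longrightarrow> j \<le> DIM('a) \<Longrightarrow> W i \<subseteq> W j"
    and sum: "\<And>i. i \<le> DIM('a) \<Longrightarrow> {x + y | x y. x \<in> V i \<and> y \<in> W (DIM('a) - i)} = UNIV"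
  obtains bs where "length bs = DIM('a)"
    "\<And>i. i \<le> DIM('a) \<Longrightarrow> ordered_basis (V i) (take i bs)"
    "\<And>i. i \<le> DIM('a) \<Longrightarrow> ordered_basis (W (DIM('a) - i)) (drop i bs)"
proof -
  let ?n = "DIM('a)"
  have Int: "V i \<inter> W (?n - i) \<subseteq> {0}" if "i \<le> ?n" for i
  proof -
    have "dim {x + y | x y. x \<in> V i \<and> y \<in> W (?n - i)} + dim (V i \<inter> W (?n - i)) = i + (?n - i)"
      using dim_sums_Int[of "V i" "W (?n - i)"] V[OF that] W[of "?n - i"] by simp
    then have "dim (V i \<inter> W (?n - i)) = 0" using that sum[OF that] by simp
    then show ?thesis by simp
  qed
  have "\<exists>a. a \<in> V (Suc j) \<inter> W (?n - j) \<and> a \<noteq> 0" if "j < ?n" for j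
  proof -
    have "dim {x + y | x y. x \<in> V (Suc j) \<and> y \<in> W (?n - j)} + dim (V (Suc j) \<inter> W (?n - j))
        = Suc j + (?n - j)"
      using dim_sums_Int[of "V (Suc j)" "W (?n - j)"] V[of "Suc j"] W[of "?n - j"] that by simp
    moreover have "dim {x + y | x y. x \<in> V (Suc j) \<and> y \<in> W (?n - j)} \<le> ?n"
      by (rule dim_subset_UNIV)
    ultimately have "dim (V (Suc j) \<inter> W (?n - j)) \<noteq> 0" using that by linarith
    then show ?thesis by auto
  qed
  then obtain a where a: "\<And>j. j < ?n \<Longrightarrow> a j \<in> V (Suc j)" "\<And>j. j < ?n \<Longrightarrow> a j \<in> W (?n - j)"
      "\<And>j. j < ?n \<Longrightarrow> a j \<noteq> 0"
    by (metis IntE)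
  define bs where "bs = map a [0..<?n]"
  have len: "length bs = ?n" by (simp add: bs_def)
  have take: "distinct (take i bs) \<and> Real_Vector_Spaces.independent (set (take i bs)) \<and>
      set (take i bs) \<subseteq> V i" if "i \<le> ?n" for i
    using that
  proof (induction i)
    case 0
    show ?case by (simp add: independent_empty)
  next
    case (Suc i)
    have eq: "take (Suc i) bs = take i bs @ [a i]"
      using Suc.prems by (simp add: bs_def take_Suc_conv_app_nth)
    have IH: "distinct (take i bs)" "Real_Vector_Spaces.independent (set (take i bs))"
      "set (take i bs) \<subseteq> V i" using Suc by auto
    \<comment> \<open>A vector of \<open>V i\<close> that lies in \<open>W (n - i)\<close> vanishes, so \<open>a i\<close> is a new direction.\<close>
    have "a i \<notin> V i" using Int[of i] a[of i] Suc.prems by auto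
    moreover have "Real_Vector_Spaces.span (set (take i bs)) \<subseteq> V i"
      using IH(3) V[of i] Suc.prems by (intro span_minimal) auto
    ultimately have new: "a i \<notin> Real_Vector_Spaces.span (set (take i bs))" by blast
    then have "Real_Vector_Spaces.independent (insert (a i) (set (take i bs)))"
      using IH(2) by (rule independent_insertI)
    moreover have "a i \<notin> set (take i bs)" using new span_base by blast
    moreover have "V i \<subseteq> V (Suc i)" using V_mono Suc.prems by simp
    ultimately show ?case
      unfolding eq using IH a(1)[of i] Suc.prems by auto
  qed
  have 1: "ordered_basis (V i) (take i bs)" if "i \<le> ?n" for i
    using take[OF that] V[OF that] len that by (intro ordered_basis_if_independent) auto
  have 2: "ordered_basis (W (?n - i)) (drop i bs)" if "i \<le> ?n" for i
  proof (rule ordered_basis_if_independent)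
    show "set (drop i bs) \<subseteq> W (?n - i)"
    proof
      fix x assume "x \<in> set (drop i bs)"
      then obtain j where "i \<le> j" "j < ?n" "x = a j"
        by (auto simp: bs_def drop_map)
      then show "x \<in> W (?n - i)" using a(2)[of j] W_mono[OF diff_le_mono2[of i j ?n]] by auto
    qed
    have all: "distinct bs" "Real_Vector_Spaces.independent (set bs)" using take[of ?n] len by auto
    show "distinct (drop i bs)" using all(1) by simp
    show "Real_Vector_Spaces.independent (set (drop i bs))"
      using all(2) set_drop_subset by (rule independent_mono)
    show "subspace (W (?n - i))" "length (drop i bs) = dim (W (?n - i))"
      using W[of "?n - i"] len by auto
  qed
  show thesis by (rule that[OF len 1 2])
qed

lemma prod_telescope_signs:
  fixes s :: "nat \<Rightarrow> real"
  assumes "\<And>i. s i * s i = 1"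
  shows "(\<Prod>j<i. s j * s (Suc j)) = s 0 * s i"
proof (induction i)
  case (Suc i)
  then have "(\<Prod>j<Suc i. s j * s (Suc j)) = s 0 * (s i * s i) * s (Suc i)" by (simp add: mult_ac)
  then show ?case using assms by simp
qed (simp add: assms)

text \<open>Let \<open>s i\<close> be the sign by which the \<open>i\<close>-th initial segment misses the wanted orientation.
  With factors \<open>s j * s (j + 1)\<close> the determinant for the \<open>i\<close>-th segment telescopes to \<open>s i\<close>, which
  corrects all segments at once.\<close>

lemma scale_to_orientations:
  fixes bs :: "'a::euclidean_space list"
  assumes basis: "\<And>i. i \<le> length bs \<Longrightarrow> ordered_basis (V i) (take i bs)"
    and orient: "\<And>i. 1 \<le> i \<Longrightarrow> i \<le> length bs \<Longrightarrow> X i \<in> orientations (V i)"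
  obtains c where "\<And>j. c j \<noteq> 0"
    "\<And>i. 1 \<le> i \<Longrightarrow> i \<le> length bs \<Longrightarrow> take i (scale c bs) \<in> X i"
proof -
  define s :: "nat \<Rightarrow> real" where "s i = (if i = 0 \<or> take i bs \<in> X i then 1 else -1)" for i
  define c where "c j = s j * s (Suc j)" for j
  have c: "c j \<noteq> 0" for j by (simp add: c_def s_def)
  have prod: "(\<Prod>j<i. c j) = s i" for i
    unfolding c_def by (subst prod_telescope_signs) (simp_all add: s_def)
  have "take i (scale c bs) \<in> X i" if i: "1 \<le> i" "i \<le> length bs" for i
  proof -
    note b = basis[OF i(2)]
    have b': "ordered_basis (V i) (scale c (take i bs))"
      using b c by (rule ordered_basis_scale)
    have det: "basis_det (take i bs) (scale c (take i bs)) = s i"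
      using basis_det_scale[OF b, of c] i by (simp add: prod min_def)
    show ?thesis
    proof (cases "take i bs \<in> X i")
      case True
      then have "s i = 1" by (simp add: s_def)
      then show ?thesis
        using orientation_eq_class(1)[OF orient[OF i] True] b b' det
        by (simp add: take_scale orientation_rel_iff)
    next
      case False
      then have "s i = -1" using i by (simp add: s_def)
      then show ?thesis
        using orientation_contains_opposite[OF orient[OF i] b False b'] det
        by (simp add: take_scale)
    qed
  qed
  with c show thesis by (rule that)
qed

text \<open>Reversing the first vector of the second block reverses the orientation of the whole
  concatenation, so in an oriented direct sum the orientations of the sum and of the first
  summand determine that of the second.\<close>

lemma oriented_sum_cancel_left:
  fixes E :: "'a::euclidean_space list"
  assumes "X \<in> orientations U" "E \<in> X" "0 < length E - p"
    and "take p E \<in> A" "B \<in> orientations W" "ordered_basis W (drop p E)"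
    and sum: "\<And>bs cs. bs \<in> A \<Longrightarrow> cs \<in> B \<Longrightarrow> ordered_basis U (bs @ cs) \<Longrightarrow> bs @ cs \<in> X"
  shows "drop p E \<in> B"
proof (rule ccontr)
  assume notin: "drop p E \<notin> B"
  let ?c = "\<lambda>j. if j = p then -1 else 1 :: real"
  note E = orientation_eq_class[OF assms(1,2)]
  have b: "ordered_basis U (scale ?c E)"
    by (rule ordered_basis_scale[OF E(2)]) simp
  have b': "ordered_basis W (drop p (scale ?c E))"
    unfolding drop_scale by (rule ordered_basis_scale[OF assms(6)]) simp
  have "basis_det (drop p E) (drop p (scale ?c E)) = (\<Prod>j<length E - p. if j = 0 then -1 else 1)"
    unfolding drop_scale basis_det_scale[OF assms(6)] by (intro prod.cong) auto
  also have "\<dots> = -1" using assms(3) by (simp add: prod.delta)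
  finally have "drop p (scale ?c E) \<in> B"
    using orientation_contains_opposite[OF assms(5,6) notin b'] by simp
  moreover have "take p (scale ?c E) = take p E"
    by (rule nth_equalityI) auto
  ultimately have "scale ?c E \<in> X"
    using sum[OF assms(4), of "drop p (scale ?c E)"] b append_take_drop_id[of p "scale ?c E"] by simp
  then have "basis_det E (scale ?c E) > 0" using E(1) by (simp add: orientation_rel_iff)
  moreover have "basis_det E (scale ?c E) = -1"
    using assms(3) by (simp add: basis_det_scale[OF E(2)] prod.delta)
  ultimately show False by simp
qed

text \<open>The lines are determined by the flags and the signs are chosen to fit the first lift and
  the standard orientation. The second lift then fits automatically, because its orientations
  can be read off from the oriented direct sums.\<close>

lemma adapted_exists:
  fixes F1 F2 :: "'n::{finite,linorder} oriented_flag"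
  assumes "F1 \<in> Flag_plus" "F2 \<in> Flag_plus" "oriented_transverse F1 F2"
  obtains E where "adapted E F1 F2"
proof -
  let ?n = "CARD('n)"
  obtain L1 L2 where L: "L1 \<in> F1" "L2 \<in> F2"
    and T: "\<And>i. i \<in> {1..<?n} \<Longrightarrow> oriented_sum (L1 i) (L2 (?n - i)) = standard_space"
    using assms(3) by (auto simp: oriented_transverse_def)
  note L1 = Flag_plus_eq_class[OF assms(1) L(1)] and L2 = Flag_plus_eq_class[OF assms(2) L(2)]
  \<comment> \<open>Complete the flags by the zero space and the whole space.\<close>
  define ext where "ext L i = (if i = 0 then {0} else if i < ?n then fst (L i) else UNIV)"
    for L :: "'n lift" and i
  have sub: "subspace (ext L i) \<and> dim (ext L i) = i" if "L \<in> flag_lifts" "i \<le> ?n" for L i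
    using that by (auto simp: ext_def flag_lifts_def dim_UNIV)
  have mono: "ext L i \<subseteq> ext L j" if "L \<in> flag_lifts" "i \<le> j" "j \<le> ?n" for L i j
    using that by (auto simp: ext_def flag_lifts_def intro: subspace_0)
  have sum: "{x + y | x y. x \<in> ext L1 i \<and> y \<in> ext L2 (?n - i)} = UNIV" if "i \<le> ?n" for i
  proof -
    consider "i = 0" | "i \<in> {1..<?n}" | "i = ?n" using \<open>i \<le> ?n\<close> by force
    then show ?thesis
    proof cases
      case 2
      then have "ext L1 i = fst (L1 i)" "ext L2 (?n - i) = fst (L2 (?n - i))"
        by (auto simp: ext_def)
      then show ?thesis
        using arg_cong[OF T[OF 2], of fst] by (simp add: oriented_sum_def Let_def standard_space_def)
    qed (auto simp: ext_def)
  qed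
  have n: "DIM(real ^ 'n::{finite,linorder}) = ?n" by simp
  obtain bs :: "(real ^ 'n::{finite,linorder}) list" where bs: "length bs = ?n"
    "\<And>i. i \<le> ?n \<Longrightarrow> ordered_basis (ext L1 i) (take i bs)"
    "\<And>i. i \<le> ?n \<Longrightarrow> ordered_basis (ext L2 (?n - i)) (drop i bs)"
    using transverse_flags_adapted_lines[of "ext L1" "ext L2"] sub[OF L1(1)] sub[OF L2(1)]
      mono[OF L1(1)] mono[OF L2(1)] sum unfolding n by blast
  define X where "X i = (if i < ?n then snd (L1 i) else snd standard_space)" for i
  have X: "X i \<in> orientations (ext L1 i)" if "1 \<le> i" "i \<le> ?n" for i
    using that L1(1) standard_orientation by (auto simp: X_def ext_def flag_lifts_def)
  obtain c where c: "\<And>j. c j \<noteq> 0" "\<And>i. 1 \<le> i \<Longrightarrow> i \<le> ?n \<Longrightarrow> take i (scale c bs) \<in> X i"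
    using scale_to_orientations[of bs "ext L1" X] bs(1,2) X by metis
  define E where "E = scale c bs"
  have lenE: "length E = ?n" by (simp add: E_def bs)
  have std: "E \<in> snd standard_space"
    using c(2)[of ?n] lenE by (simp add: E_def X_def)
  have take: "take i E \<in> snd (L1 i)" if "i \<in> {1..<?n}" for i
    using c(2)[of i] that by (simp add: E_def X_def)
  have dropE: "ordered_basis (fst (L2 i)) (drop (?n - i) E)" if "i \<in> {1..<?n}" for i
  proof -
    have "ext L2 (?n - (?n - i)) = fst (L2 i)" using that by (auto simp: ext_def)
    with bs(3)[of "?n - i"] have "ordered_basis (fst (L2 i)) (drop (?n - i) bs)" by simp
    then show ?thesis unfolding E_def drop_scale using c(1) by (rule ordered_basis_scale)
  qed
  have L_orient: "snd (L i) \<in> orientations (fst (L i))" if "L \<in> flag_lifts" "i \<in> {1..<?n}"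
    for L :: "'n lift" and i
    using that by (auto simp: flag_lifts_def)
  have drop: "drop (?n - i) E \<in> snd (L2 i)" if i: "i \<in> {1..<?n}" for i
  proof (rule oriented_sum_cancel_left[OF standard_orientation std])
    have p: "?n - i \<in> {1..<?n}" "?n - (?n - i) = i" using i by auto
    show "0 < length E - (?n - i)" using i lenE by simp
    show "take (?n - i) E \<in> snd (L1 (?n - i))" by (rule take[OF p(1)])
    show "snd (L2 i) \<in> orientations (fst (L2 i))" by (rule L_orient[OF L2(1) i])
    show "ordered_basis (fst (L2 i)) (drop (?n - i) E)" by (rule dropE[OF i])
    fix ds cs :: "(real ^ 'n::{finite,linorder}) list"
    assume *: "ds \<in> snd (L1 (?n - i))" "cs \<in> snd (L2 i)" "ordered_basis UNIV (ds @ cs)"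
    have T': "oriented_sum (L1 (?n - i)) (L2 i) = standard_space" using T[OF p(1)] p(2) by simp
    have "fst (oriented_sum (L1 (?n - i)) (L2 i)) = UNIV"
      unfolding T' by (simp add: standard_space_def)
    then have "snd (oriented_sum (L1 (?n - i)) (L2 i)) =
        orientation_rel UNIV `` {bs @ cs | bs cs. bs \<in> snd (L1 (?n - i)) \<and> cs \<in> snd (L2 i)}"
      by (simp add: oriented_sum_def Let_def)
    moreover have "(ds @ cs, ds @ cs) \<in> orientation_rel UNIV"
      using *(3) by (simp add: orientation_rel_iff)
    ultimately have "ds @ cs \<in> snd (oriented_sum (L1 (?n - i)) (L2 i))"
      using *(1,2) by blast
    then show "ds @ cs \<in> snd standard_space" unfolding T' .
  qed
  have eq: "oriented_span cs = L i" if "L \<in> flag_lifts" "i \<in> {1..<?n}" "cs \<in> snd (L i)"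
    for L :: "'n lift" and i cs
    using orientation_eq_class[OF L_orient[OF that(1,2)] that(3)]
    by (simp add: oriented_span_eq prod_eq_iff)
  have ext: "L i = undefined" if "L \<in> flag_lifts" "i \<notin> {1..<?n}" for L :: "'n lift" and i
    using that by (auto simp: flag_lifts_def extensional_def)
  have "(\<lambda>i\<in>{1..<?n}. oriented_span (take i E)) = L1"
    using eq[OF L1(1) _ take] ext[OF L1(1)] by (auto simp: restrict_def fun_eq_iff)
  moreover have "(\<lambda>i\<in>{1..<?n}. oriented_span (drop (?n - i) E)) = L2"
    using eq[OF L2(1) _ drop] ext[OF L2(1)] by (auto simp: restrict_def fun_eq_iff)
  ultimately have "adapted E F1 F2"
    using std L1(2) L2(2) by (simp add: adapted_def)
  then show thesis by (rule that)
qed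

section \<open>Complementary halfspaces\<close>

lemma S_minus_opposite:
  fixes F1 F2 :: "'n::{finite,linorder} oriented_flag"
  assumes "even CARD('n)" "adapted E F1 F2" "adapted D F2 F1"
  shows "S_minus D v + S_plus E v = CARD('n) - 1"
proof -
  note b = adapted_ordered_basis[OF assms(2)]
  obtain c e where c: "D = scale c (alt_rev E)" "e \<in> {-1, 1 :: real}"
      "\<And>j. j < CARD('n) \<Longrightarrow> e * c j > 0"
    using adapted_unique[OF assms(1) adapted_alt_rev[OF assms(1,2)] assms(3)] by metis
  have "S_minus D v = S_minus (alt_rev E) v"
    unfolding c(1) using adapted_length[OF assms(2)] c(2,3)
    by (intro S_minus_scale_basis[OF ordered_basis_alt_rev[OF b], of _ e]) auto
  then show ?thesis
    using S_minus_alt_rev[OF b, of v] adapted_length[OF assms(2)] by simp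
qed

lemma span_singleton_eq:
  assumes "Real_Vector_Spaces.span {v} = Real_Vector_Spaces.span {w}" "w \<noteq> 0"
  obtains a :: real where "w = a *\<^sub>R v" "a \<noteq> 0"
proof -
  have "w \<in> Real_Vector_Spaces.span {v}" using assms(1) by (simp add: span_base)
  then obtain a :: real where "w = a *\<^sub>R v" by (auto simp: span_singleton)
  with assms(2) show thesis by (intro that[of a]) auto
qed

theorem lemma5p4:
  fixes k :: nat and F1 F2 :: "'n::{finite,linorder} oriented_flag"
  assumes "CARD('n) = 2 * k"
    and "F1 \<in> Flag_plus" and "F2 \<in> Flag_plus"
    and "oriented_transverse F1 F2"
  shows "projective_space - open_halfspace F1 F2 = closed_halfspace F2 F1"
proof -
  have even: "even CARD('n)" and k: "k > 0"
    using assms(1) zero_less_card_finite[where 'a = 'n] by auto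
  define E where "E = adapted_basis F1 F2"
  define D where "D = adapted_basis F2 F1"
  obtain E' where E': "adapted E' F1 F2" using adapted_exists[OF assms(2-4)] .
  then have E: "adapted E F1 F2"
    unfolding E_def adapted_basis_def by (rule someI)
  have D: "adapted D F2 F1"
    unfolding D_def adapted_basis_def by (rule someI) (rule adapted_alt_rev[OF even E'])
  have iff: "S_minus D v \<le> k - 1 \<longleftrightarrow> \<not> S_plus E v \<le> k - 1" for v
    using S_minus_opposite[OF even E D, of v] assms(1) k by linarith
  have open_iff: "Real_Vector_Spaces.span {v} \<in> open_halfspace F1 F2 \<longleftrightarrow> S_plus E v \<le> k - 1"
    if "v \<noteq> 0" for v
  proof
    assume "Real_Vector_Spaces.span {v} \<in> open_halfspace F1 F2"
    then obtain w where w: "Real_Vector_Spaces.span {v} = Real_Vector_Spaces.span {w}" "w \<noteq> 0"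
        "S_plus E w \<le> k - 1"
      using assms(1) by (auto simp: open_halfspace_def E_def)
    obtain a where "w = a *\<^sub>R v" "a \<noteq> 0" using span_singleton_eq[OF w(1,2)] .
    then show "S_plus E v \<le> k - 1"
      using S_plus_scale_vector[OF adapted_ordered_basis[OF E], of v a] w(3) by simp
  next
    assume "S_plus E v \<le> k - 1"
    then show "Real_Vector_Spaces.span {v} \<in> open_halfspace F1 F2"
      using that assms(1) by (auto simp: open_halfspace_def E_def)
  qed
  have "closed_halfspace F2 F1 =
      {Real_Vector_Spaces.span {v} | v. v \<noteq> 0 \<and> \<not> S_plus E v \<le> k - 1}"
    using assms(1) iff by (simp add: closed_halfspace_def flip: D_def)
  then show ?thesis
    using open_iff by (auto simp: projective_space_def)
qed

end
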